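(* For any cycle $C_n$ of order $n\ge 3$, $\gamma_{tc}(M(C_n))=2n-3$.
   Context: All graphs are finite, simple and undirected. For a graph $H$, a set $D\subseteq V(H)$ is a total dominating set if every vertex of $H$ has a neighbor in $D$. A set $D\subseteq V(H)$ is a total outer-connected dominating set of $H$ if $D$ is a total dominating set and the induced subgraph $H[V(H)\setminus D]$ is connected; $\gamma_{tc}(H)$ denotes the minimum cardinality of a total outer-connected dominating set of $H$. The middle graph $M(G)$ of a graph $G$ has vertex set $V(G)\cup E(G)$, where two elements $x,y$ are adjacent iff either $x,y\in E(G)$ are edges of $G$ sharing an endpoint, or one of them is a vertex of $G$ and the other is an edge of $G$ incident to it. *)

theory Defs
  imports "Graph_Theory.Graph_Theory"
begin

text \<open>
  Finite simple undirected graphs are the \<^locale>\<open>pair_graph\<close>s: finite, loop-free,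
  symmetric digraphs whose arcs are pairs of vertices.  An undirected edge is the two-element set
  of its endpoints, so that it counts as a single vertex of the middle graph although it
  corresponds to two arcs.
\<close>

definition edges :: "'a pair_pre_digraph \<Rightarrow> 'a set set" where
  "edges G = {{u, v} | u v. (u, v) \<in> parcs G}"

text \<open>
  A cycle of order \<open>n\<close>, with an arbitrary vertex type.  The definition is meant for \<open>n \<ge> 3\<close> only;
  see \<open>cycle_graph_pair_graph\<close> below.
\<close>

definition is_cycle_graph :: "nat \<Rightarrow> 'a pair_pre_digraph \<Rightarrow> bool" where
  "is_cycle_graph n G \<longleftrightarrow> (\<exists>f :: nat \<Rightarrow> 'a. bij_betw f {..<n} (pverts G) \<and>
     parcs G = {(f i, f (Suc i mod n)) | i. i < n} \<union> {(f (Suc i mod n), f i) | i. i < n})"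

definition middle_graph :: "'a pair_pre_digraph \<Rightarrow> ('a + 'a set) pair_pre_digraph" where
  "middle_graph G = \<lparr>
     pverts = Inl ` pverts G \<union> Inr ` edges G,
     parcs = {(Inr e, Inr e') | e e'. e \<in> edges G \<and> e' \<in> edges G \<and> e \<noteq> e' \<and> e \<inter> e' \<noteq> {}}
           \<union> {(Inl v, Inr e) | v e. v \<in> pverts G \<and> e \<in> edges G \<and> v \<in> e}
           \<union> {(Inr e, Inl v) | v e. v \<in> pverts G \<and> e \<in> edges G \<and> v \<in> e} \<rparr>"

definition total_dominating_set :: "'a pair_pre_digraph \<Rightarrow> 'a set \<Rightarrow> bool" where
  "total_dominating_set H D \<longleftrightarrow>
     D \<subseteq> pverts H \<and> (\<forall>v \<in> pverts H. \<exists>u \<in> D. (v, u) \<in> parcs H)"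

definition total_outer_connected_dominating_set :: "'a pair_pre_digraph \<Rightarrow> 'a set \<Rightarrow> bool" where
  "total_outer_connected_dominating_set H D \<longleftrightarrow>
     total_dominating_set H D \<and>
     Digraph_Component.connected (with_proj H \<restriction> (pverts H - D))"

definition gamma_tc :: "'a pair_pre_digraph \<Rightarrow> nat" where
  "gamma_tc H = Min (card ` {D. total_outer_connected_dominating_set H D})"

lemma cycle_graph_card:
  assumes "is_cycle_graph n G"
  shows "card (pverts G) = n"
  using assms unfolding is_cycle_graph_def by (metis bij_betw_same_card card_lessThan)

lemma cycle_graph_pair_graph:
  assumes "n \<ge> 3" "is_cycle_graph n G"
  shows "pair_graph G"
proof -
  from assms(2) obtain f :: "nat \<Rightarrow> 'a" where f: "bij_betw f {..<n} (pverts G)"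
    and arcs: "parcs G = {(f i, f (Suc i mod n)) | i. i < n} \<union> {(f (Suc i mod n), f i) | i. i < n}"
    unfolding is_cycle_graph_def by blast
  have in_verts: "f i \<in> pverts G" if "i < n" for i
    using f that by (auto simp: bij_betw_def)
  have less: "Suc i mod n < n" for i
    using assms(1) by simp
  have neq: "f i \<noteq> f (Suc i mod n)" if "i < n" for i
  proof -
    have "Suc i mod n \<noteq> i"
      using that assms(1) by (cases "Suc i = n") auto
    then show ?thesis
      using f that less[of i] by (auto simp: bij_betw_def inj_on_def)
  qed
  have fin: "finite (pverts G)"
    using f bij_betw_finite by blast
  have sub: "parcs G \<subseteq> pverts G \<times> pverts G"
    unfolding arcs using in_verts less by blast
  show ?thesis
  proof
    show "finite (parcs G)"
      using sub fin finite_subset by blast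
    show "symmetric (with_proj G)"
      unfolding symmetric_def with_proj_simps arcs sym_def by blast
    show "fst e \<noteq> snd e" if "e \<in> parcs G" for e
      using that neq unfolding arcs by (auto dest: sym)
  qed (use fin sub in auto)
qed

lemma middle_graph_pair_graph:
  assumes "pair_graph G"
  shows "pair_graph (middle_graph G)"
proof -
  interpret pair_graph G by fact
  have "edges G \<subseteq> Pow (pverts G)"
    unfolding edges_def by (auto dest: in_arcsD1 in_arcsD2)
  then have fin: "finite (pverts (middle_graph G))"
    using pair_finite_verts finite_subset by (fastforce simp: middle_graph_def)
  have sub: "parcs (middle_graph G) \<subseteq> pverts (middle_graph G) \<times> pverts (middle_graph G)"
    unfolding middle_graph_def by auto
  show ?thesis
  proof
    show "finite (parcs (middle_graph G))"
      using sub fin finite_subset by blast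
    show "symmetric (with_proj (middle_graph G))"
      unfolding symmetric_def with_proj_simps sym_def middle_graph_def by auto
    show "fst e \<noteq> snd e" if "e \<in> parcs (middle_graph G)" for e
      using that unfolding middle_graph_def by auto
  qed (use fin sub in auto)
qed

end

theory Submission
  imports Defs
begin

text \<open>
  Let \<open>D\<close> be a total outer-connected dominating set of \<open>M(G)\<close>, where \<open>G\<close> is 2-regular, and let
  \<open>S\<close> be its complement. A vertex \<open>v\<close> of \<open>G\<close> is dominated only by its two incident edges,
  so at most one of these lies in \<open>S\<close>. Hence the component in \<open>S\<close> of an edge \<open>{u, v}\<close> is
  contained in \<open>{u, v, {u, v}}\<close>, and connectedness of \<open>S\<close> gives \<open>card S \<le> 3\<close>. Conversely, the
  complement of \<open>{u, v, {u, v}}\<close> is a total outer-connected dominating set for every edge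
  \<open>{u, v}\<close>. As \<open>M(G)\<close> has \<open>2 * n\<close> vertices, the minimum is \<open>2 * n - 3\<close>.
\<close>

section \<open>Connectedness of induced subgraphs\<close>

text \<open>A walk inside \<open>S\<close> that starts in \<open>A\<close> can never leave
  \<open>A\<close>, and connectedness reaches every vertex of \<open>S\<close> by such a walk. This
  confines the complement of a dominating set to the neighborhood of one edge.\<close>

lemma connected_induced_subset_closed:
  assumes sym: "symmetric (with_proj H)"
    and conn: "Digraph_Component.connected (with_proj H \<restriction> S)"
    and x: "x \<in> S" "x \<in> A"
    and closed: "\<And>u v. u \<in> A \<Longrightarrow> v \<in> S \<Longrightarrow> (u, v) \<in> parcs H \<Longrightarrow> v \<in> A"
  shows "S \<subseteq> A"
proof
  fix y assume "y \<in> S"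
  let ?K = "mk_symmetric (with_proj H \<restriction> S)"
  \<comment> \<open>Connectedness is defined through the symmetric closure \<open>?K\<close>;
    symmetry of \<open>H\<close> turns the reversed arcs back into arcs of \<open>H\<close>.\<close>
  have arcs: "(u, v) \<in> parcs H \<and> v \<in> S" if "(u, v) \<in> parcs ?K" for u v
    using that sym by (auto simp: parcs_mk_symmetric symmetric_def dest: symD)
  have "x \<rightarrow>\<^sup>*\<^bsub>with_proj ?K\<^esub> y"
    using conn x(1) \<open>y \<in> S\<close>
    by (auto simp: Digraph_Component.connected_def strongly_connected_def)
  then have "(x, y) \<in> rtrancl_on S (parcs ?K)"
    by (simp add: reachable_def)
  then show "y \<in> A"
    by (induction rule: rtrancl_on_induct) (use x(2) closed arcs in blast)+
qed

text \<open>Any two vertices are joined through the center \<open>c\<close>. Arcs leaving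
  \<open>c\<close> suffice, because the symmetric closure supplies the way back.\<close>

lemma connected_induced_star:
  assumes c: "c \<in> S" and star: "\<And>v. v \<in> S \<Longrightarrow> v \<noteq> c \<Longrightarrow> (c, v) \<in> parcs H"
  shows "Digraph_Component.connected (with_proj H \<restriction> S)"
proof -
  let ?K = "mk_symmetric (with_proj H \<restriction> S)"
  have arcs: "(c, v) \<in> parcs ?K" "(v, c) \<in> parcs ?K" if "v \<in> S" "v \<noteq> c" for v
    using star[OF that] that c by (force simp: parcs_mk_symmetric)+
  have to: "(v, c) \<in> rtrancl_on S (parcs ?K)" if "v \<in> S" for v
    using that c arcs(2)[OF that]
    by (cases "v = c") (auto intro: rtrancl_on_into_rtrancl_on)
  have from_c: "(c, v) \<in> rtrancl_on S (parcs ?K)" if "v \<in> S" for v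
    using that c arcs(1)[OF that]
    by (cases "v = c") (auto intro: rtrancl_on_into_rtrancl_on)
  have "u \<rightarrow>\<^sup>*\<^bsub>with_proj ?K\<^esub> v" if "u \<in> S" "v \<in> S" for u v
    using rtrancl_on_trans[OF to from_c] that by (simp add: reachable_def)
  then show ?thesis
    using c by (auto simp: Digraph_Component.connected_def strongly_connected_def)
qed

section \<open>Counting edges and vertices of the middle graph\<close>

context pair_graph
begin

lemma finite_edges: "finite (edges G)"
proof -
  have "edges G = (\<lambda>(u, v). {u, v}) ` parcs G"
    unfolding edges_def by auto
  then show ?thesis by simp
qed

lemma edge_subset_verts: "e \<in> edges G \<Longrightarrow> e \<subseteq> pverts G"
  unfolding edges_def by (auto dest: in_arcsD1 in_arcsD2)

lemma card_edge: "e \<in> edges G \<Longrightarrow> card e = 2"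
  using pair_no_loops by (fastforce simp: edges_def card_2_iff)

text \<open>Double counting of incidences: two edges at each vertex, two endpoints on each
  edge.\<close>

lemma card_edges_two_regular:
  assumes "\<And>v. v \<in> pverts G \<Longrightarrow> card {e \<in> edges G. v \<in> e} = 2"
  shows "card (edges G) = card (pverts G)"
proof -
  have "{v \<in> pverts G. v \<in> e} = e" if "e \<in> edges G" for e
    using edge_subset_verts[OF that] by auto
  then have "(\<Sum>v\<in>pverts G. card {e \<in> edges G. v \<in> e}) = 2 * card (edges G)"
    by (intro sum_multicount) (auto simp: finite_edges card_edge)
  then show ?thesis using assms by simp
qed

lemma card_middle_graph:
  "card (pverts (middle_graph G)) = card (pverts G) + card (edges G)"
proof -
  have "card (pverts (middle_graph G)) = card (pverts G <+> edges G)"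
    by (simp add: middle_graph_def Plus_def)
  then show ?thesis by (simp add: finite_edges card_Plus)
qed

section \<open>Lower and upper bound in terms of degrees\<close>

lemma card_outer_connected_complement_le_3:
  assumes deg: "\<And>v. v \<in> pverts G \<Longrightarrow> card {e \<in> edges G. v \<in> e} \<le> 2"
    and D: "total_outer_connected_dominating_set (middle_graph G) D"
  shows "card (pverts (middle_graph G) - D) \<le> 3"
proof -
  let ?M = "middle_graph G"
  define S where "S = pverts ?M - D"
  have sym: "symmetric (with_proj ?M)"
    unfolding symmetric_def with_proj_simps sym_def middle_graph_def by auto
  have conn: "Digraph_Component.connected (with_proj ?M \<restriction> S)"
    and dom: "\<And>x. x \<in> pverts ?M \<Longrightarrow> \<exists>y\<in>D. (x, y) \<in> parcs ?M"
    using D by (auto simp: S_def total_outer_connected_dominating_set_def total_dominating_set_def)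
  have one_edge: "e = e'"
    if e: "Inr e \<in> S" "Inr e' \<in> S" "v \<in> e" "v \<in> e'" for e e' v
  proof (rule ccontr)
    assume "e \<noteq> e'"
    have edges: "e \<in> edges G" "e' \<in> edges G"
      using e by (auto simp: S_def middle_graph_def)
    then have v: "v \<in> pverts G"
      using edge_subset_verts e(3) by blast
    \<comment> \<open>The edge dominating \<open>v\<close> would be a third edge at
      \<open>v\<close>, against the degree bound.\<close>
    then obtain d where d: "Inr d \<in> D" "d \<in> edges G" "v \<in> d"
      using dom[of "Inl v"] by (auto simp: middle_graph_def)
    have "d \<noteq> e" "d \<noteq> e'"
      using d e by (auto simp: S_def)
    then have "card {d, e, e'} = 3"
      using \<open>e \<noteq> e'\<close> by simp
    moreover have "card {d, e, e'} \<le> card {e \<in> edges G. v \<in> e}"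
      using d e edges finite_edges by (intro card_mono) auto
    ultimately show False
      using deg[OF v] by simp
  qed
  have "card S \<le> 3"
  proof (cases "\<exists>e. Inr e \<in> S")
    case True
    then obtain e where e: "Inr e \<in> S" ..
    have "e \<in> edges G"
      using e by (auto simp: S_def middle_graph_def)
    then have card_e: "card e = 2" "finite e"
      using card_edge by (auto intro: card_ge_0_finite)
    let ?A = "insert (Inr e) (Inl ` e) :: ('a + 'a set) set"
    \<comment> \<open>By \<open>one_edge\<close>, no other edge in \<open>S\<close> meets
      \<open>e\<close>, so neither \<open>e\<close> nor an endpoint of \<open>e\<close> has a
      neighbor in \<open>S\<close> outside \<open>?A\<close>.\<close>
    have "S \<subseteq> ?A"
    proof (rule connected_induced_subset_closed[OF sym conn e])
      fix x y assume "x \<in> ?A" "y \<in> S" "(x, y) \<in> parcs ?M"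
      then show "y \<in> ?A"
        using one_edge[OF e] by (fastforce simp: middle_graph_def)
    qed simp
    then have "card S \<le> card ?A"
      using card_e by (intro card_mono) auto
    also have "\<dots> = 3"
      using card_e by (simp add: card_insert_if card_image image_iff)
    finally show ?thesis .
  next
    case False
    \<comment> \<open>Connectedness includes nonemptiness. Without edges \<open>S\<close> is an
      independent set of \<open>M(G)\<close>, hence a single vertex.\<close>
    obtain x where x: "x \<in> S"
      using conn by (auto simp: Digraph_Component.connected_def strongly_connected_def)
    have "S \<subseteq> {x}"
    proof (rule connected_induced_subset_closed[OF sym conn x])
      fix u v assume "u \<in> {x}" "v \<in> S" "(u, v) \<in> parcs ?M"
      then show "v \<in> {x}"
        using False x by (auto simp: middle_graph_def)
    qed simp
    then have "card S \<le> card {x}"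
      by (intro card_mono) auto
    then show ?thesis by simp
  qed
  then show ?thesis by (simp add: S_def)
qed

text \<open>Every vertex lies on an edge other than \<open>e\<close>, which dominates it; the
  removed set is a star with center \<open>e\<close>.\<close>

lemma outer_connected_complement_of_edge:
  assumes deg: "\<And>v. v \<in> pverts G \<Longrightarrow> card {e \<in> edges G. v \<in> e} \<ge> 2"
    and e: "e \<in> edges G"
  shows "total_outer_connected_dominating_set (middle_graph G)
           (pverts (middle_graph G) - insert (Inr e) (Inl ` e))"
proof -
  let ?M = "middle_graph G"
  let ?A = "insert (Inr e) (Inl ` e) :: ('a + 'a set) set"
  let ?D = "pverts ?M - ?A"
  have A: "?A \<subseteq> pverts ?M"
    using e edge_subset_verts[OF e] by (auto simp: middle_graph_def)
  have other: "\<exists>d. d \<in> edges G \<and> v \<in> d \<and> d \<noteq> e" if "v \<in> pverts G" for v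
  proof (rule ccontr)
    assume "\<nexists>d. d \<in> edges G \<and> v \<in> d \<and> d \<noteq> e"
    then have "{d \<in> edges G. v \<in> d} \<subseteq> {e}" by auto
    then have "card {d \<in> edges G. v \<in> d} \<le> card {e}"
      by (intro card_mono) auto
    then show False using deg[OF that] by simp
  qed
  have "\<exists>y\<in>?D. (x, y) \<in> parcs ?M" if x: "x \<in> pverts ?M" for x
  proof (cases x)
    case (Inl v)
    then have v: "v \<in> pverts G"
      using x by (auto simp: middle_graph_def)
    then obtain d where "d \<in> edges G" "v \<in> d" "d \<noteq> e"
      using other by blast
    then show ?thesis
      using Inl v by (intro bexI[of _ "Inr d"]) (auto simp: middle_graph_def)
  next
    case (Inr d)
    then have d: "d \<in> edges G"
      using x by (auto simp: middle_graph_def)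
    show ?thesis
    proof (cases "d = e")
      case True
      \<comment> \<open>The vertex \<open>e\<close> of \<open>M(G)\<close> is dominated by a second
        edge at one of its endpoints.\<close>
      obtain v where v: "v \<in> e"
        using card_edge[OF e] by (auto simp: card_2_iff)
      then obtain d' where "d' \<in> edges G" "v \<in> d'" "d' \<noteq> e"
        using other edge_subset_verts[OF e] by blast
      then show ?thesis
        using Inr True e v by (intro bexI[of _ "Inr d'"]) (auto simp: middle_graph_def)
    next
      case False
      \<comment> \<open>Distinct two-element sets are not nested, so \<open>d\<close> has an
        endpoint outside \<open>e\<close>, and that endpoint dominates \<open>d\<close>.\<close>
      have "\<not> d \<subseteq> e"
        using False card_edge[OF d] card_edge[OF e] card_subset_eq[of e d] card_ge_0_finite[of e]
        by auto
      then obtain w where "w \<in> d" "w \<notin> e" by blast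
      then show ?thesis
        using Inr d edge_subset_verts[OF d]
        by (intro bexI[of _ "Inl w"]) (auto simp: middle_graph_def)
    qed
  qed
  moreover have "Digraph_Component.connected (with_proj ?M \<restriction> ?A)"
    using e edge_subset_verts[OF e]
    by (intro connected_induced_star[of "Inr e"]) (auto simp: middle_graph_def)
  moreover have "pverts ?M - ?D = ?A"
    using A by blast
  ultimately show ?thesis
    by (auto simp: total_outer_connected_dominating_set_def total_dominating_set_def)
qed

text \<open>The argument is local, so it also covers disjoint unions of cycles.\<close>

theorem gamma_tc_middle_graph_two_regular:
  assumes deg: "\<And>v. v \<in> pverts G \<Longrightarrow> card {e \<in> edges G. v \<in> e} = 2"
    and nonempty: "pverts G \<noteq> {}"
  shows "gamma_tc (middle_graph G) = 2 * card (pverts G) - 3"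
proof -
  let ?M = "middle_graph G"
  let ?\<D> = "{D. total_outer_connected_dominating_set ?M D}"
  have fin: "finite (pverts ?M)"
    by (simp add: middle_graph_def finite_edges)
  have card: "card (pverts ?M) = 2 * card (pverts G)"
    using card_middle_graph card_edges_two_regular[OF deg] by simp
  have sub: "D \<subseteq> pverts ?M" if "D \<in> ?\<D>" for D
    using that by (simp add: total_outer_connected_dominating_set_def total_dominating_set_def)
  have "finite ?\<D>"
    using fin sub by (intro finite_subset[of ?\<D> "Pow (pverts ?M)"]) auto
  have lower: "2 * card (pverts G) - 3 \<le> card D" if "D \<in> ?\<D>" for D
  proof -
    have "card (pverts ?M - D) \<le> 3"
      using that deg by (intro card_outer_connected_complement_le_3) auto
    then show ?thesis
      using card_Diff_subset[OF finite_subset[OF sub[OF that] fin] sub[OF that]] card by simp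
  qed
  obtain v where "v \<in> pverts G"
    using nonempty by blast
  then have "{e \<in> edges G. v \<in> e} \<noteq> {}"
    using deg[of v] by (metis card.empty zero_neq_numeral)
  then obtain e where e: "e \<in> edges G" by blast
  let ?A = "insert (Inr e) (Inl ` e) :: ('a + 'a set) set"
  have "finite e"
    using card_edge[OF e] by (auto intro: card_ge_0_finite)
  then have "card ?A = 3"
    using card_edge[OF e] by (simp add: card_insert_if card_image image_iff)
  moreover have "?A \<subseteq> pverts ?M"
    using e edge_subset_verts[OF e] by (auto simp: middle_graph_def)
  ultimately have "card (pverts ?M - ?A) = 2 * card (pverts G) - 3"
    using card \<open>finite e\<close> by (simp add: card_Diff_subset)
  moreover have "pverts ?M - ?A \<in> ?\<D>"
    using outer_connected_complement_of_edge[OF _ e] deg by simp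
  ultimately have "2 * card (pverts G) - 3 \<in> card ` ?\<D>"
    by (metis imageI)
  then show ?thesis
    unfolding gamma_tc_def using \<open>finite ?\<D>\<close> lower by (intro Min_eqI) auto
qed

end

section \<open>Cycles are 2-regular\<close>

lemma cycle_graph_two_regular:
  assumes n: "n \<ge> 3" and G: "is_cycle_graph n G" and v: "v \<in> pverts G"
  shows "card {e \<in> edges G. v \<in> e} = 2"
proof -
  from G obtain f :: "nat \<Rightarrow> 'a" where f: "bij_betw f {..<n} (pverts G)"
    and arcs: "parcs G = {(f i, f (Suc i mod n)) | i. i < n} \<union> {(f (Suc i mod n), f i) | i. i < n}"
    unfolding is_cycle_graph_def by blast
  have edges: "edges G = {{f i, f (Suc i mod n)} | i. i < n}"
    unfolding edges_def arcs by (auto simp: insert_commute)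
  have inj: "f i = f j \<longleftrightarrow> i = j" if "i < n" "j < n" for i j
    using f that by (auto simp: bij_betw_def inj_on_def)
  obtain k where k: "k < n" "v = f k"
    using f v by (auto simp: bij_betw_def)
  define s where "s = Suc k mod n"
  \<comment> \<open>\<open>p\<close> is the cyclic predecessor of \<open>k\<close>; index 0 wraps
    around to \<open>n - 1\<close>.\<close>
  define p where "p = (if k = 0 then n - 1 else k - 1)"
  have p: "p < n" "Suc p mod n = k" and s: "s < n" and ne: "p \<noteq> s" "p \<noteq> k" "s \<noteq> k"
    using k n by (auto simp: p_def s_def mod_Suc)
  have pred: "i = p" if "i < n" "Suc i mod n = k" for i
    using that n by (auto simp: p_def mod_Suc split: if_splits)
  have "{e \<in> edges G. v \<in> e} = {{f k, f s}, {f p, f k}}"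
  proof (intro equalityI subsetI)
    fix e assume "e \<in> {e \<in> edges G. v \<in> e}"
    then obtain i where i: "i < n" "e = {f i, f (Suc i mod n)}" "f k \<in> e"
      using k edges by auto
    then have "i = k \<or> Suc i mod n = k"
      using inj k n by auto
    then show "e \<in> {{f k, f s}, {f p, f k}}"
      using i pred by (auto simp: s_def)
  next
    fix e assume "e \<in> {{f k, f s}, {f p, f k}}"
    then show "e \<in> {e \<in> edges G. v \<in> e}"
      using k p by (auto simp: edges s_def)
  qed
  \<comment> \<open>Here \<open>n \<ge> 3\<close> matters: it makes predecessor and successor
    distinct, so the two edges at \<open>v\<close> do not coincide.\<close>
  moreover have "{f k, f s} \<noteq> {f p, f k}"
    using inj k p s ne by (auto simp: doubleton_eq_iff)
  ultimately show ?thesis by simp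
qed

theorem theorem2p3:
  fixes n :: nat and G :: "'a pair_pre_digraph"
  assumes "n \<ge> 3" and "is_cycle_graph n G"
  shows "gamma_tc (middle_graph G) = 2 * n - 3"
proof -
  interpret pair_graph G
    by (rule cycle_graph_pair_graph[OF assms])
  have "card (pverts G) = n"
    by (rule cycle_graph_card[OF assms(2)])
  then show ?thesis
    using gamma_tc_middle_graph_two_regular cycle_graph_two_regular[OF assms] assms(1) by force
qed

end
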